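(* Let $s \in \mathbb{N}$. Then for all $k \in \mathbb{Z}$ it holds that $$\lim_{z\to s} K_z(k) = \frac{\mathbf{1}_{\{1,2,\ldots,s\}}(|k|)\,(-1)^{k+1}\,\Gamma(2s+1)}{\Gamma(1+s+k)\,\Gamma(1+s-k)},$$ where the limit is taken over $z$ in the domain $(0,\infty)\setminus\mathbb{N}$ on which $K_z$ is defined.
   Context: $\mathbb{N} = \{1,2,3,\ldots\}$. $\mathbf{1}_A$ is the indicator function of the set $A$. $\Gamma$ is the Gamma function (meromorphically continued), with the convention $1/\Gamma(w) = 0$ for $w \in \{\ldots,-2,-1,0\}$. The discrete fractional kernel: for $z \in (0,\infty)\setminus\mathbb{N}$ the function $K_z \colon \mathbb{Z}\to\mathbb{R}$ is given by $K_z(0)=0$ and, for $k \ne 0$, $$K_z(k) = \frac{-4^z\,\Gamma(\tfrac12+z)\,\Gamma(|k|-z)}{\sqrt{\pi}\,\Gamma(-z)\,\Gamma(|k|+1+z)}.$$ *)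

theory Defs
  imports "HOL-Analysis.Analysis"
begin

definition kernel_domain :: "real set" where
  "kernel_domain = {0<..} - real ` {1..}"

text \<open>
  The value is meaningful only for \<open>z \<in> kernel_domain\<close>. There, none of the Gamma factors
  is evaluated at a pole. The convention that \<open>1 / Gamma w = 0\<close> at the poles of \<open>Gamma\<close> needs no case
  distinction: the library sets \<open>Gamma w = 0\<close> there, and division by zero yields zero.
\<close>

definition frac_kernel :: "real \<Rightarrow> int \<Rightarrow> real" where
  "frac_kernel z k =
     (if k = 0 then 0
      else (- (4 powr z) * Gamma (1/2 + z) * Gamma (of_int \<bar>k\<bar> - z))
           / (sqrt pi * Gamma (- z) * Gamma (of_int \<bar>k\<bar> + 1 + z)))"

end

theory Submission
  imports Defs
begin

text \<open>
  For fixed \<open>k \<noteq> 0\<close> the kernel is, on its domain, the restriction of a continuous function of \<open>z\<close>.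
  Two identities show this. Legendre's duplication formula turns the factor
  \<open>4\<^sup>z \<Gamma>(1/2 + z) / \<surd>\<pi>\<close> into \<open>\<Gamma>(2z + 1) / \<Gamma>(z + 1)\<close>. The quotient \<open>\<Gamma>(|k| - z) / \<Gamma>(-z)\<close>,
  whose numerator and denominator may both blow up as \<open>z\<close> tends to an integer, is the Pochhammer
  polynomial \<open>(-z)(-z + 1) \<dots> (-z + |k| - 1)\<close>. Reversing the order and the signs of its factors
  makes it \<open>(-1)\<^sup>k \<Gamma>(z + 1) / \<Gamma>(1 + z - |k|)\<close>. The two factors \<open>\<Gamma>(z + 1)\<close> cancel, and what remains
  is \<open>(-1)\<^bsup>|k|+1\<^esup> \<Gamma>(2z + 1) / (\<Gamma>(1 + z + |k|) \<Gamma>(1 + z - |k|))\<close>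
  (\<open>frac_kernel_eq_rGamma\<close>).

  The reciprocal Gamma function is entire, so the limit at \<open>z = s\<close> is the value there. If
  \<open>|k| > s\<close>, that value vanishes because \<open>1 + s - |k|\<close> is a pole of Gamma; this is the source of the
  indicator function. The remaining formula is symmetric in \<open>k\<close>, so the absolute value can be dropped.
\<close>

lemma Gamma_legendre_duplication_powr:
  fixes z :: real
  assumes "z > 0"
  shows "4 powr z * Gamma (1/2 + z) / sqrt pi = Gamma (2 * z + 1) * rGamma (z + 1)"
proof -
  have dup: "Gamma z * Gamma (z + 1/2) = exp ((1 - 2 * z) * ln 2) * sqrt pi * Gamma (2 * z)"
  proof -
    have "z \<notin> \<int>\<^sub>\<le>\<^sub>0" "z + 1/2 \<notin> \<int>\<^sub>\<le>\<^sub>0"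
      using assms by (auto dest: nonpos_Ints_nonpos)
    then have "complex_of_real z \<notin> \<int>\<^sub>\<le>\<^sub>0" "complex_of_real z + 1/2 \<notin> \<int>\<^sub>\<le>\<^sub>0"
      using of_real_in_nonpos_Ints_iff[of z, where 'a = complex]
        of_real_in_nonpos_Ints_iff[of "z + 1/2", where 'a = complex] by simp_all
    from Gamma_legendre_duplication[OF this]
    have "complex_of_real (Gamma z * Gamma (z + 1/2))
            = of_real (exp ((1 - 2 * z) * ln 2) * sqrt pi * Gamma (2 * z))"
      by (simp flip: Gamma_complex_of_real exp_of_real)
    then show ?thesis
      by (simp only: of_real_eq_iff)
  qed
  have expo: "exp ((1 - 2 * z) * ln 2) * 4 powr z = 2"
  proof -
    have "(4::real) powr z = exp (2 * z * ln 2)"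
      using ln_realpow[of 2 2] by (simp add: powr_def)
    then show ?thesis
      by (simp add: exp_add [symmetric] algebra_simps)
  qed
  have shift: "Gamma (z + 1) = z * Gamma z" "Gamma (2 * z + 1) = 2 * z * Gamma (2 * z)"
    using assms by (auto intro!: Gamma_plus1 dest: nonpos_Ints_nonpos)
  have "4 powr z * Gamma (1/2 + z) * Gamma (z + 1)
          = z * 4 powr z * (Gamma z * Gamma (z + 1/2))"
    by (simp only: shift(1) add.commute[of "1/2"] mult_ac)
  also have "\<dots> = z * (exp ((1 - 2 * z) * ln 2) * 4 powr z) * sqrt pi * Gamma (2 * z)"
    by (simp only: dup mult_ac)
  also have "\<dots> = sqrt pi * Gamma (2 * z + 1)"
    by (simp only: expo) (simp add: shift)
  finally have "4 powr z * Gamma (1/2 + z) * Gamma (z + 1) = sqrt pi * Gamma (2 * z + 1)" .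
  moreover have "Gamma (z + 1) \<noteq> 0"
    using Gamma_real_pos[of "z + 1"] assms by linarith
  ultimately show ?thesis
    by (simp add: rGamma_inverse_Gamma divide_simps)
qed

text \<open>
  Multiplying the Pochhammer polynomial at \<open>-z\<close> factor by factor with \<open>-1\<close> gives the one that climbs
  from \<open>z + 1 - n\<close> to \<open>z\<close>, and this is again a quotient of Gamma values.
\<close>

lemma Gamma_quotient_reflect:
  fixes z :: real
  assumes "z \<notin> \<int>"
  shows "Gamma (real n - z) / Gamma (- z) * rGamma (z + 1) = (-1) ^ n * rGamma (1 + z - real n)"
proof -
  have "- z \<notin> \<int>\<^sub>\<le>\<^sub>0"
    using assms nonpos_Ints_Int by fastforce
  then have "Gamma (real n - z) / Gamma (- z) = pochhammer (- z) n"
    using pochhammer_Gamma[of "- z" n] by simp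
  also have "\<dots> = (-1) ^ n * pochhammer (z - real n + 1) n"
    by (rule pochhammer_minus)
  finally show ?thesis
    using pochhammer_rGamma[of "z - real n + 1" n] by (simp add: algebra_simps)
qed

text \<open>
  Reciprocal Gamma factors replace the removable singularities at the integers by honest values,
  so the right-hand side is continuous in all \<open>z > 0\<close>.
\<close>

lemma frac_kernel_eq_rGamma:
  assumes "z \<in> kernel_domain" and "k \<noteq> 0"
  shows "frac_kernel z k = - ((-1) ^ nat \<bar>k\<bar>) * Gamma (2 * z + 1)
           * (rGamma (1 + z + \<bar>k\<bar>) * rGamma (1 + z - \<bar>k\<bar>))"
proof -
  define n where "n = nat \<bar>k\<bar>"
  have n: "real_of_int \<bar>k\<bar> = real n"
    by (simp add: n_def)
  have pos: "z > 0" and nonint: "z \<notin> \<int>"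
  proof -
    show "z > 0"
      using assms(1) by (simp add: kernel_domain_def)
    show "z \<notin> \<int>"
    proof
      assume "z \<in> \<int>"
      with \<open>z > 0\<close> obtain m :: nat where "z = real m" "m \<ge> 1"
        by (elim Ints_cases) (metis One_nat_def Suc_leI of_int_0_less_iff of_nat_0_less_iff
            of_int_of_nat_eq pos_int_cases)
      with assms(1) show False
        by (auto simp: kernel_domain_def)
    qed
  qed
  have "frac_kernel z k = - (4 powr z * Gamma (1/2 + z) / sqrt pi)
          * (Gamma (real n - z) / Gamma (- z)) * rGamma (1 + z + real n)"
    using assms(2) by (simp add: frac_kernel_def n [simplified] rGamma_inverse_Gamma field_simps)
  also have "\<dots> = - Gamma (2 * z + 1) * (Gamma (real n - z) / Gamma (- z) * rGamma (z + 1))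
          * rGamma (1 + z + real n)"
    by (simp only: Gamma_legendre_duplication_powr[OF pos] mult_ac minus_mult_left minus_mult_right)
  also have "\<dots> = - ((-1) ^ n) * Gamma (2 * z + 1)
          * (rGamma (1 + z + real n) * rGamma (1 + z - real n))"
    by (subst Gamma_quotient_reflect[OF nonint]) (simp add: mult_ac)
  finally show ?thesis
    by (simp only: n n_def [symmetric])
qed

theorem lemma6p2:
  fixes s :: nat and k :: int
  assumes "s \<ge> 1"
  shows "((\<lambda>z. frac_kernel z k) \<longlongrightarrow>
           (indicator {1..int s} \<bar>k\<bar> * (-1) powi (k + 1) * Gamma (2 * real s + 1))
             / (Gamma (1 + real s + of_int k) * Gamma (1 + real s - of_int k)))
         (at (real s) within kernel_domain)"
proof (cases "k = 0")
  case True
  then show ?thesis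
    by (simp add: frac_kernel_def)
next
  case False
  define F where "F z = - ((-1) ^ nat \<bar>k\<bar>) * Gamma (2 * z + 1)
    * (rGamma (1 + z + \<bar>k\<bar>) * rGamma (1 + z - \<bar>k\<bar>))" for z :: real
  have "2 * real s + 1 \<notin> \<int>\<^sub>\<le>\<^sub>0"
    by (auto dest: nonpos_Ints_nonpos)
  then have "(F \<longlongrightarrow> F (real s)) (at (real s) within kernel_domain)"
    unfolding F_def
    by (intro tendsto_intros isCont_tendsto_compose[of _ rGamma] isCont_rGamma continuous_ident)
  moreover have "\<forall>\<^sub>F z in at (real s) within kernel_domain. F z = frac_kernel z k"
    using False by (simp add: eventually_at_filter F_def frac_kernel_eq_rGamma)
  ultimately have "((\<lambda>z. frac_kernel z k) \<longlongrightarrow> F (real s)) (at (real s) within kernel_domain)"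
    by (rule Lim_transform_eventually)
  moreover have "F (real s) = (indicator {1..int s} \<bar>k\<bar> * (-1) powi (k + 1) * Gamma (2 * real s + 1))
      / (Gamma (1 + real s + of_int k) * Gamma (1 + real s - of_int k))"
  proof -
    have sign: "- ((-1) ^ nat \<bar>k\<bar>) = ((-1) powi (k + 1) :: real)"
      by (cases "even k") (simp_all add: power_int_minus_one_minus even_nat_iff)
    have sym: "rGamma (1 + real s + \<bar>k\<bar>) * rGamma (1 + real s - \<bar>k\<bar>)
        = rGamma (1 + real s + k) * rGamma (1 + real s - k)"
      by (cases "k \<ge> 0") simp_all
    have vanish: "rGamma (1 + real s - \<bar>k\<bar>) = 0" if "\<bar>k\<bar> > int s"
    proof -
      have "1 + real s - \<bar>k\<bar> = of_int (1 + int s - \<bar>k\<bar>)"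
        by simp
      also have "\<dots> \<in> \<int>\<^sub>\<le>\<^sub>0"
        using that by (intro nonpos_Ints_of_int) simp
      finally show ?thesis
        by (simp add: rGamma_eq_zero_iff)
    qed
    have "F (real s) = indicator {1..int s} \<bar>k\<bar> * F (real s)"
      using False vanish by (cases "\<bar>k\<bar> \<le> int s") (auto simp: F_def)
    also have "\<dots> = indicator {1..int s} \<bar>k\<bar> * ((-1) powi (k + 1) * Gamma (2 * real s + 1)
        * (rGamma (1 + real s + k) * rGamma (1 + real s - k)))"
      by (simp only: F_def sign sym)
    finally show ?thesis
      by (simp add: rGamma_inverse_Gamma field_simps)
  qed
  ultimately show ?thesis
    by simp
qed

end
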